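(* The modified partial Petrial polynomial of bouquets satisfies the four-term relation; that is, for every (framed) chord diagram $B$ and every two adjacent chords $a,b$ of $B$, $${}^{M\partial}\varepsilon_{B}^{\times}(z)-{}^{M\partial}\varepsilon_{\widetilde{B}_{a,b}}^{\times}(z)+{}^{M\partial}\varepsilon_{\widetilde{B^{\prime}}_{a,b}}^{\times}(z)-{}^{M\partial}\varepsilon_{B^{\prime}_{a,b}}^{\times}(z)=0.$$
   Context: A bouquet is a ribbon graph with exactly one vertex-disc, i.e. a surface with boundary obtained from one closed disc by attaching finitely many edge-ribbons (closed discs), each along two disjoint boundary segments, all segments being disjoint. A loop is twisted if it (together with the vertex-disc) is homeomorphic to a Möbius band and untwisted if it is homeomorphic to an annulus. A chord diagram is an oriented circle with finitely many chords with pairwise distinct endpoints; it is framed, i.e. each chord is declared untwisted (framing $0$) or twisted (framing $1$). Chord diagrams are identified with bouquets: the circle is the boundary of the vertex-disc, chords are edge-ribbons, and twisted/untwisted chords are twisted/untwisted loops. For a bouquet $B$, the Euler genus is $\varepsilon(B)=1+|E(B)|-|F(B)|$, where $F(B)$ is the set of boundary components of $B$. For $A\subseteq E(B)$, the partial Petrial $B^{\times|A}$ is obtained by adding a half-twist to each edge-ribbon in $A$ (i.e. switching the framing of each chord in $A$). The modified partial Petrial polynomial is ${}^{M\partial}\varepsilon^{\times}_{B}(z)=\sum_{A\subseteq E(B)}(-1)^{|A|}z^{\varepsilon(B^{\times|A})}$. Two chords $a,b$ are adjacent in $B$ if an endpoint $a_1$ of $a$ and an endpoint $b_1$ of $b$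 are consecutive on the circle; fix such a pair, and let $b_2$ be the other endpoint of $b$. - $B^{\prime}_{a,b}$ is obtained from $B$ by exchanging the two adjacent endpoints $a_1$ and $b_1$. - $\widetilde{B}_{a,b}$ is obtained from $B$ by sliding the end $a_1$ of $a$ along the edge-ribbon $b$ to the other end $b_2$ of $b$. Explicitly, if $b$ is untwisted and $a_1$ is immediately before (resp. after) $b_1$ in the cyclic order, then $a_1$ is moved to be immediately after (resp. before) $b_2$ and the framing of $a$ is unchanged; if $b$ is twisted and $a_1$ is immediately before (resp. after) $b_1$, then $a_1$ is moved to be immediately before (resp. after) $b_2$ and the framing of $a$ is switched. - $\widetilde{B^{\prime}}_{a,b}$ denotes the composition of the two operations, $(\widetilde{B}_{a,b})^{\prime}_{a,b}=\widetilde{(B^{\prime}_{a,b})}_{a,b}$ (in $\widetilde{B}_{a,b}$ the exchanged endpoints are the moved end $a_1$ and $b_2$). *)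

theory Defs
  imports
    "HOL-Combinatorics.Transposition"
    "HOL-Computational_Algebra.Polynomial"
begin

section \<open>Framed chord diagrams (bouquets)\<close>

text \<open>
  A chord labelled \<open>e\<close> has the two endpoints \<open>(e, False)\<close> and \<open>(e, True)\<close>. The field \<open>circle\<close>
  lists all endpoints in the order in which they are met on the oriented circle, starting from
  an arbitrary base point; everything below depends on this list only up to rotation.
\<close>

type_synonym 'e endpoint = "'e \<times> bool"

record 'e diagram =
  circle :: "'e endpoint list"
  twisted :: "'e set"

definition chords :: "'e diagram \<Rightarrow> 'e set" where
  "chords B = fst ` set (circle B)"

definition framed_chord_diagram :: "'e diagram \<Rightarrow> bool" where
  "framed_chord_diagram B \<longleftrightarrow>
     distinct (circle B) \<and> set (circle B) = chords B \<times> UNIV \<and> twisted B \<subseteq> chords B"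

fun other_end :: "'e endpoint \<Rightarrow> 'e endpoint" where
  "other_end (e, s) = (e, \<not> s)"

text \<open>Cyclic succession: the last entry of the list is immediately before the first one.\<close>

definition immediately_before :: "'e diagram \<Rightarrow> 'e endpoint \<Rightarrow> 'e endpoint \<Rightarrow> bool" where
  "immediately_before B p q \<longleftrightarrow> (p, q) \<in> set (zip (circle B) (rotate1 (circle B)))"

definition consecutive :: "'e diagram \<Rightarrow> 'e endpoint \<Rightarrow> 'e endpoint \<Rightarrow> bool" where
  "consecutive B p q \<longleftrightarrow> immediately_before B p q \<or> immediately_before B q p"


section \<open>Boundary components and Euler genus\<close>

text \<open>
  The edge-ribbon of \<open>e\<close> is attached to the vertex-disc along a boundary segment at each of its
  two endpoints \<open>p\<close>; \<open>Before p\<close> and \<open>After p\<close> are the initial and the final point of that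
  segment with respect to the orientation of the circle. The boundary of the surface consists of
  the arcs of the circle between consecutive segments and of the two free sides of each ribbon.
  The ribbon together with the vertex-disc is an annulus if its free sides join initial points
  to final points, and a Moebius band if they join initial to initial and final to final points.
\<close>

datatype 'e corner = Before "'e endpoint" | After "'e endpoint"

definition corners :: "'e diagram \<Rightarrow> 'e corner set" where
  "corners B = Before ` set (circle B) \<union> After ` set (circle B)"

definition disc_arcs :: "'e diagram \<Rightarrow> ('e corner \<times> 'e corner) set" where
  "disc_arcs B = {(After p, Before q) | p q. immediately_before B p q}"

definition ribbon_sides :: "'e diagram \<Rightarrow> ('e corner \<times> 'e corner) set" where
  "ribbon_sides B = (\<Union>e\<in>chords B.
     if e \<in> twisted B
     then {(Before (e, False), Before (e, True)), (After (e, False), After (e, True))}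
     else {(Before (e, False), After (e, True)), (After (e, False), Before (e, True))})"

definition same_component :: "'e diagram \<Rightarrow> ('e corner \<times> 'e corner) set" where
  "same_component B =
     (let R = disc_arcs B \<union> ribbon_sides B in (R \<union> R\<inverse>)\<^sup>*)"

text \<open>
  A boundary component is represented by the set of corners lying on it. Without chords the
  surface is the bare disc, whose only boundary component contains no corner.
\<close>

definition boundary_components :: "'e diagram \<Rightarrow> 'e corner set set" where
  "boundary_components B =
     (if chords B = {} then {{}} else corners B // same_component B)"

definition euler_genus :: "'e diagram \<Rightarrow> int" where
  "euler_genus B = 1 + int (card (chords B)) - int (card (boundary_components B))"


section \<open>The modified partial Petrial polynomial\<close>

definition toggle :: "'e set \<Rightarrow> 'e diagram \<Rightarrow> 'e diagram" where
  "toggle A B = B\<lparr>twisted := (twisted B - A) \<union> (A - twisted B)\<rparr>"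

definition partial_petrial :: "'e diagram \<Rightarrow> 'e set \<Rightarrow> 'e diagram" where
  "partial_petrial B A = toggle A B"

text \<open>
  The conversion of the exponent to \<open>nat\<close> loses nothing: attaching a ribbon raises the number of
  boundary components by at most one, so the Euler genus of a framed chord diagram is nonnegative.
\<close>

definition modified_partial_petrial_poly :: "'e diagram \<Rightarrow> int poly" where
  "modified_partial_petrial_poly B =
     (\<Sum>A\<in>Pow (chords B). monom ((-1) ^ card A) (nat (euler_genus (partial_petrial B A))))"


section \<open>The operations in the four-term relation\<close>

definition exchange_ends :: "'e endpoint \<Rightarrow> 'e endpoint \<Rightarrow> 'e diagram \<Rightarrow> 'e diagram" where
  "exchange_ends p q B = B\<lparr>circle := map (transpose p q) (circle B)\<rparr>"

definition move_before :: "'e endpoint \<Rightarrow> 'e endpoint \<Rightarrow> 'e diagram \<Rightarrow> 'e diagram" where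
  "move_before p q B = B\<lparr>circle :=
     concat (map (\<lambda>r. if r = p then [] else if r = q then [p, q] else [r]) (circle B))\<rparr>"

definition move_after :: "'e endpoint \<Rightarrow> 'e endpoint \<Rightarrow> 'e diagram \<Rightarrow> 'e diagram" where
  "move_after p q B = B\<lparr>circle :=
     concat (map (\<lambda>r. if r = p then [] else if r = q then [q, p] else [r]) (circle B))\<rparr>"

text \<open>
  \<open>slide_end p q B\<close> slides the end \<open>p\<close> along the ribbon with end \<open>q\<close>. It is meant for consecutive
  endpoints \<open>p\<close>, \<open>q\<close> of two different chords; then exactly one of them is immediately before the
  other, because the circle carries at least four endpoints.
\<close>

definition slide_end :: "'e endpoint \<Rightarrow> 'e endpoint \<Rightarrow> 'e diagram \<Rightarrow> 'e diagram" where
  "slide_end p q B =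
     (if fst q \<notin> twisted B
      then (if immediately_before B p q then move_after p (other_end q) B
            else move_before p (other_end q) B)
      else toggle {fst p}
           (if immediately_before B p q then move_before p (other_end q) B
            else move_after p (other_end q) B))"

end

theory Submission
  imports Defs
begin

text \<open>
  Fix the circle and let the framing vary. Toggling a set \<open>A\<close> of chords turns the framing \<open>T\<close>
  into the symmetric difference \<open>S\<close> of \<open>T\<close> and \<open>A\<close>, and \<open>(-1)\<^sup>|\<^sup>A\<^sup>|\<close> is the product of the
  signs \<open>(-1)\<^sup>|\<^sup>T\<^sup>|\<close> and \<open>(-1)\<^sup>|\<^sup>S\<^sup>|\<close>. Hence up to the sign of \<open>T\<close> the polynomial depends only on
  the circle: it is the sum \<open>Q\<close>, over all framings \<open>S\<close> of the circle, of \<open>(-1)\<^sup>|\<^sup>S\<^sup>|\<close> times the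
  power of \<open>z\<close> given by the Euler genus (\<open>framing_sum\<close>,
  \<open>modified_partial_petrial_poly_eq\<close>).

  Write \<open>b'\<close> for the other end of \<open>b\<close>. The four diagrams in the relation arise by inserting the
  end \<open>a\<close> into one and the same cyclic word \<open>b xs b' ys\<close> at four places: before \<open>b\<close>, after \<open>b\<close>,
  after \<open>b'\<close> or before \<open>b'\<close>. A slide along the ribbon of \<open>b\<close> does not change the Euler genus.
  If \<open>b\<close> is untwisted in \<open>S\<close>, this pairs ``before \<open>b\<close>'' with ``after \<open>b'\<close>'' and ``after \<open>b\<close>''
  with ``before \<open>b'\<close>'', with equal signs. If \<open>b\<close> is twisted in \<open>S\<close>, it pairs ``before \<open>b\<close>'' with
  ``before \<open>b'\<close>'' and ``after \<open>b\<close>'' with ``after \<open>b'\<close>'', and the framing of the chord of \<open>a\<close>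
  changes, so the signs are opposite. Splitting each \<open>Q\<close> by the framing of \<open>b\<close> gives
  \<open>Q(before b) + Q(before b') = Q(after b) + Q(after b')\<close>: the untwisted parts of the two sides
  agree and the twisted parts of each side cancel (\<open>four_term_framing_sum\<close>). Whether \<open>b\<close> is twisted
  in the given diagram only decides which of the two slides is the tilde operation. In the twisted
  case the slide also switches the framing of \<open>a\<close> and hence the global sign of the two slid diagrams, so
  that the same relation between the four sums results.

  The geometric input is thus the invariance of the number of boundary components under a slide.
  It is shown as an inequality by a map of corners that hits all components
  (\<open>slide_untwisted_le\<close>, \<open>slide_twisted_le\<close>); up to rotating and reversing the circle, undoing a
  slide is again such a slide, which gives the converse inequality.
\<close>


section \<open>Paths and cycles of endpoints\<close>

text \<open>
  The successor relation of a word read linearly. A cyclic word \<open>x # xs\<close> is cut open as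
  \<open>x # xs @ [x]\<close>, so that moving one letter becomes a statement about subpaths.
\<close>

definition links :: "'a list \<Rightarrow> ('a \<times> 'a) set" where
  "links xs = set (zip xs (tl xs))"

lemma links_simps [simp]:
  "links [] = {}" "links [x] = {}" "links (x # y # ys) = insert (x, y) (links (y # ys))"
  by (auto simp: links_def)

lemma links_append: "links (xs @ y # ys) = links (xs @ [y]) \<union> links (y # ys)"
proof (induction xs)
  case (Cons x xs)
  then show ?case by (cases xs) auto
qed simp

lemma links_rev: "links (rev xs) = (links xs)\<inverse>"
proof (induction xs)
  case (Cons x xs)
  then show ?case
  proof (cases xs)
    case (Cons y ys)
    have "links (rev (x # xs)) = links (rev ys @ y # [x])" using Cons by simp
    also have "\<dots> = links (rev xs) \<union> {(y, x)}" by (subst links_append) (simp add: Cons)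
    finally show ?thesis using Cons.IH Cons by auto
  qed simp
qed simp

text \<open>
  A slide leaves the two long stretches of the circle intact and only replaces the letters at
  their ends.
\<close>

lemma links_change_ends:
  assumes "(p, q) \<in> links (x # ys @ [y])" "x \<notin> set ys" "y \<notin> set ys"
  shows "(if p = x then x' else p, if q = y then y' else q) \<in> links (x' # ys @ [y'])"
proof -
  have *: "links (u # ys @ [v]) = set (zip (u # ys) (ys @ [v]))" for u v :: 'a
    using zip_append[of "u # ys" "ys @ [v]" "[v]" "[]"] by (simp add: links_def)
  define \<sigma> \<tau> where "\<sigma> = (\<lambda>p. if p = x then x' else p)" and "\<tau> = (\<lambda>q. if q = y then y' else q)"
  have "map \<sigma> (x # ys) = x' # ys" "map \<tau> (ys @ [y]) = ys @ [y']"
    using assms by (auto simp: \<sigma>_def \<tau>_def intro!: map_idI)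
  then have "zip (x' # ys) (ys @ [y']) = map (map_prod \<sigma> \<tau>) (zip (x # ys) (ys @ [y]))"
    by (metis zip_map_map map_prod_def)
  moreover have "(p, q) \<in> set (zip (x # ys) (ys @ [y]))" using assms * by simp
  ultimately have "map_prod \<sigma> \<tau> (p, q) \<in> set (zip (x' # ys) (ys @ [y']))"
    by (metis image_eqI image_set)
  then show ?thesis using * by (simp add: \<sigma>_def \<tau>_def)
qed

lemma links_ends_in_set:
  assumes "(p, q) \<in> links (x # ys @ [y])"
  shows "(p = x \<or> p \<in> set ys) \<and> (q = y \<or> q \<in> set ys)"
proof -
  have "zip (x # ys @ [y]) (ys @ [y]) = zip (x # ys) (ys @ [y])"
    using zip_append[of "x # ys" "ys @ [y]" "[y]" "[]"] by simp
  then show ?thesis using assms by (auto simp: links_def dest: set_zip_leftD set_zip_rightD)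
qed

lemma immediately_before_Cons:
  assumes "circle B = x # xs"
  shows "immediately_before B p q \<longleftrightarrow> (p, q) \<in> links (x # xs @ [x])"
  using zip_append[of "x # xs" "xs @ [x]" "[x]" "[]"] assms
  by (simp add: immediately_before_def links_def)

lemma immediately_before_rotated:
  assumes "circle B = u @ v" "circle B' = v @ u"
  shows "immediately_before B p q \<longleftrightarrow> immediately_before B' p q"
proof (cases "u = [] \<or> v = []")
  case True
  then show ?thesis using assms by (auto simp: immediately_before_def)
next
  case False
  then obtain x u' y v' where uv: "u = x # u'" "v = y # v'" by (metis list.exhaust)
  have "immediately_before B p q \<longleftrightarrow> (p, q) \<in> links (u @ y # v' @ [x])"
    by (subst immediately_before_Cons[of _ x "u' @ v"]) (simp_all add: uv assms)
  moreover have "immediately_before B' p q \<longleftrightarrow> (p, q) \<in> links (v @ x # u' @ [y])"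
    by (subst immediately_before_Cons[of _ y "v' @ u"]) (simp_all add: uv assms)
  ultimately show ?thesis
    using links_append[of u y "v' @ [x]"] links_append[of v x "u' @ [y]"] uv by auto
qed

lemma immediately_before_rev:
  assumes "circle B' = rev (circle B)"
  shows "immediately_before B' p q \<longleftrightarrow> immediately_before B q p"
proof (cases "circle B")
  case Nil
  then show ?thesis using assms by (simp add: immediately_before_def)
next
  case (Cons x xs)
  \<comment> \<open>Reversal moves the base point to the end of the list; rotating by one step restores it.\<close>
  have "immediately_before B' p q \<longleftrightarrow> immediately_before (B'\<lparr>circle := x # rev xs\<rparr>) p q"
    by (rule immediately_before_rotated[of _ "rev xs" "[x]"]) (simp_all add: assms Cons)
  also have "\<dots> \<longleftrightarrow> (p, q) \<in> links (rev (x # xs @ [x]))"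
    by (subst immediately_before_Cons[of _ x "rev xs"]) simp_all
  also have "\<dots> \<longleftrightarrow> immediately_before B q p"
    by (simp only: links_rev immediately_before_Cons[OF Cons] converse_iff)
  finally show ?thesis .
qed

lemma immediately_before_obtains_rotation:
  assumes "immediately_before B p q" "p \<noteq> q"
  obtains u v w where "circle B = u @ v" "v @ u = p # q # w"
proof -
  define c where "c = circle B"
  obtain n where n: "n < length c" "c ! n = p" "rotate1 c ! n = q"
    using assms by (auto simp: immediately_before_def in_set_zip c_def)
  have len: "length c \<ge> 2"
  proof (rule ccontr)
    assume "\<not> length c \<ge> 2"
    then have "length c = 1" using n by simp
    then obtain x where "c = [x]" by (auto simp: length_Suc_conv)
    then show False using n assms by simp
  qed
  then have "c \<noteq> []" by auto
  have "rotate n c ! 0 = p" "rotate n c ! 1 = q"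
    using n len nth_rotate[of 0 c n] nth_rotate[of 1 c n] nth_rotate1[of n c]
    by (simp_all add: \<open>c \<noteq> []\<close>)
  moreover obtain x y w where "rotate n c = x # y # w"
    using len by (metis One_nat_def Suc_1 Suc_le_length_iff length_rotate)
  ultimately have "drop n c @ take n c = p # q # w"
    using n by (simp add: rotate_drop_take)
  then show ?thesis using that[of "take n c" "drop n c" w] by (simp add: c_def)
qed


section \<open>Counting boundary components\<close>

text \<open>The corner at the far end of the ribbon side that starts at a given corner.\<close>

fun across :: "'e set \<Rightarrow> 'e corner \<Rightarrow> 'e corner" where
  "across T (Before p) = (if fst p \<in> T then Before (other_end p) else After (other_end p))"
| "across T (After p) = (if fst p \<in> T then After (other_end p) else Before (other_end p))"

lemma fst_other_end [simp]: "fst (other_end p) = fst p"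
  by (cases p) simp

lemma other_end_other_end [simp]: "other_end (other_end p) = p"
  by (cases p) simp

lemma other_end_neq [simp]: "other_end p \<noteq> p" "p \<noteq> other_end p"
  by (cases p; simp)+

lemma same_fst_cases: "fst p = fst q \<Longrightarrow> p = q \<or> p = other_end q"
  by (cases p; cases q) auto

lemma ribbon_sides_sym:
  assumes "framed_chord_diagram B"
  shows "ribbon_sides B \<union> (ribbon_sides B)\<inverse> = {(x, across (twisted B) x) | x. x \<in> corners B}"
proof -
  have set: "set (circle B) = chords B \<times> UNIV" using assms by (simp add: framed_chord_diagram_def)
  show ?thesis
  proof (intro equalityI subrelI)
    fix x y assume "(x, y) \<in> ribbon_sides B \<union> (ribbon_sides B)\<inverse>"
    then show "(x, y) \<in> {(x, across (twisted B) x) | x. x \<in> corners B}"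
      by (auto simp: ribbon_sides_def corners_def set split: if_splits)
  next
    fix x y assume "(x, y) \<in> {(x, across (twisted B) x) | x. x \<in> corners B}"
    then have y: "y = across (twisted B) x" and "x \<in> corners B" by auto
    then obtain e s where e: "e \<in> chords B" and "x = Before (e, s) \<or> x = After (e, s)"
      by (auto simp: corners_def set)
    with y show "(x, y) \<in> ribbon_sides B \<union> (ribbon_sides B)\<inverse>"
      by (cases s; cases "e \<in> twisted B") (force simp: ribbon_sides_def)+
  qed
qed

lemma same_component_equiv: "equiv UNIV (same_component B)"
  unfolding same_component_def Let_def
  by (intro equivI) (auto simp: refl_on_def sym_Un_converse intro: sym_rtrancl trans_rtrancl)

lemma same_component_sym: "(x, y) \<in> same_component B \<Longrightarrow> (y, x) \<in> same_component B"
  using same_component_equiv[of B] by (metis equiv_def symD)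

lemma same_component_trans:
  "(x, y) \<in> same_component B \<Longrightarrow> (y, z) \<in> same_component B \<Longrightarrow> (x, z) \<in> same_component B"
  using same_component_equiv[of B] by (metis equiv_def transD)

lemma same_component_refl [simp]: "(x, x) \<in> same_component B"
  by (simp add: same_component_def Let_def)

lemma same_component_arc:
  "immediately_before B p q \<Longrightarrow> (After p, Before q) \<in> same_component B"
  unfolding same_component_def Let_def disc_arcs_def by blast

lemma same_component_across:
  assumes "framed_chord_diagram B" "x \<in> corners B"
  shows "(x, across (twisted B) x) \<in> same_component B"
proof -
  have "(x, across (twisted B) x) \<in> ribbon_sides B \<union> (ribbon_sides B)\<inverse>"
    using ribbon_sides_sym[OF assms(1)] assms(2) by blast
  then show ?thesis unfolding same_component_def Let_def by (intro r_into_rtrancl) blast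
qed

text \<open>
  As components are generated by the disc arcs and the ribbon sides, it suffices to follow these
  two kinds of elementary steps.
\<close>

lemma same_component_map:
  assumes "framed_chord_diagram B"
    and arc: "\<And>p q. immediately_before B p q \<Longrightarrow> (f (After p), f (Before q)) \<in> same_component B'"
    and ribbon: "\<And>x. x \<in> corners B \<Longrightarrow> (f x, f (across (twisted B) x)) \<in> same_component B'"
    and "(x, y) \<in> same_component B"
  shows "(f x, f y) \<in> same_component B'"
proof -
  have edge: "(f x, f y) \<in> same_component B'"
    if "(x, y) \<in> (disc_arcs B \<union> ribbon_sides B) \<union> (disc_arcs B \<union> ribbon_sides B)\<inverse>" for x y
  proof -
    have "(x, y) \<in> disc_arcs B \<or> (y, x) \<in> disc_arcs B \<or>
        (x, y) \<in> ribbon_sides B \<union> (ribbon_sides B)\<inverse>"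
      using that by blast
    then show ?thesis
      unfolding ribbon_sides_sym[OF assms(1)] disc_arcs_def
      using arc ribbon same_component_sym[of _ _ B'] by blast
  qed
  from \<open>(x, y) \<in> same_component B\<close> show ?thesis
    unfolding same_component_def[of B] Let_def
  proof (induction rule: rtrancl_induct)
    case (step y z)
    then show ?case using edge same_component_trans by blast
  qed simp
qed

text \<open>
  A map \<open>f\<close> that respects components induces a map between the sets of components, and \<open>hit\<close> makes
  the induced map surjective. The map itself may collapse corners, which is what happens when a
  stretch of boundary along the ribbon of \<open>b\<close> is contracted.
\<close>

lemma card_boundary_components_le:
  assumes "framed_chord_diagram B" "circle B \<noteq> []" "circle B' \<noteq> []"
    and arc: "\<And>p q. immediately_before B p q \<Longrightarrow> (f (After p), f (Before q)) \<in> same_component B'"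
    and ribbon: "\<And>x. x \<in> corners B \<Longrightarrow> (f x, f (across (twisted B) x)) \<in> same_component B'"
    and hit: "\<And>y. y \<in> corners B' \<Longrightarrow> \<exists>x\<in>corners B. (f x, y) \<in> same_component B'"
  shows "card (boundary_components B') \<le> card (boundary_components B)"
proof -
  let ?E = "same_component B" and ?E' = "same_component B'"
  have bc: "boundary_components B = corners B // ?E" "boundary_components B' = corners B' // ?E'"
    using assms(2,3) by (auto simp: boundary_components_def chords_def)
  have img: "?E' `` (f ` (?E `` {x})) = ?E' `` {f x}" for x
  proof
    show "?E' `` (f ` (?E `` {x})) \<subseteq> ?E' `` {f x}"
      using same_component_map[OF assms(1) arc ribbon] same_component_trans by fast
    show "?E' `` {f x} \<subseteq> ?E' `` (f ` (?E `` {x}))" by (auto intro!: imageI)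
  qed
  have "corners B' // ?E' \<subseteq> (\<lambda>X. ?E' `` (f ` X)) ` (corners B // ?E)"
  proof
    fix Y assume "Y \<in> corners B' // ?E'"
    then obtain y where y: "y \<in> corners B'" "Y = ?E' `` {y}" by (rule quotientE)
    then obtain x where x: "x \<in> corners B" "(f x, y) \<in> ?E'" using hit by blast
    have "Y = ?E' `` {f x}"
      using y x equiv_class_eq[OF same_component_equiv] by metis
    then show "Y \<in> (\<lambda>X. ?E' `` (f ` X)) ` (corners B // ?E)"
      using img[of x] quotientI[OF x(1), of ?E] by (metis image_eqI)
  qed
  moreover have "finite (corners B // ?E)"
    by (simp add: quotient_def corners_def)
  ultimately show ?thesis unfolding bc by (meson surj_card_le)
qed


section \<open>Invariance of the Euler genus\<close>

lemma euler_genus_cong: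
  assumes "set (circle B) = set (circle B')" "twisted B = twisted B'"
    and "\<And>p q. immediately_before B p q \<longleftrightarrow> immediately_before B' p q"
  shows "euler_genus B = euler_genus B'"
  using assms
  by (simp add: euler_genus_def boundary_components_def same_component_def disc_arcs_def
      ribbon_sides_def corners_def chords_def)

lemma euler_genus_rotated:
  "euler_genus \<lparr>circle = u @ v, twisted = T\<rparr> = euler_genus \<lparr>circle = v @ u, twisted = T\<rparr>"
  by (intro euler_genus_cong immediately_before_rotated[of _ u v]) auto

lemma euler_genus_le:
  assumes "set (circle B') = set (circle B)"
    and "card (boundary_components B') \<le> card (boundary_components B)"
  shows "euler_genus B \<le> euler_genus B'"
  using assms by (simp add: euler_genus_def chords_def)

fun mirror_corner :: "'e corner \<Rightarrow> 'e corner" where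
  "mirror_corner (Before p) = After p"
| "mirror_corner (After p) = Before p"

text \<open>
  Reversing the orientation of the circle exchanges the initial and the final point of each
  attaching segment; the surface is the same.
\<close>

lemma euler_genus_rev_le:
  assumes "framed_chord_diagram \<lparr>circle = c, twisted = T\<rparr>"
  shows "euler_genus \<lparr>circle = c, twisted = T\<rparr> \<le> euler_genus \<lparr>circle = rev c, twisted = T\<rparr>"
    (is "euler_genus ?B \<le> euler_genus ?B'")
proof (cases "c = []")
  case False
  have framed': "framed_chord_diagram ?B'"
    using assms by (simp add: framed_chord_diagram_def chords_def)
  have corners: "corners ?B' = corners ?B" by (simp add: corners_def)
  have "card (boundary_components ?B') \<le> card (boundary_components ?B)"
  proof (rule card_boundary_components_le[where f = mirror_corner])
    fix p q assume "immediately_before ?B p q"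
    then have "immediately_before ?B' q p" using immediately_before_rev[of ?B' ?B] by simp
    then show "(mirror_corner (After p), mirror_corner (Before q)) \<in> same_component ?B'"
      using same_component_arc same_component_sym by fastforce
  next
    fix x assume x: "x \<in> corners ?B"
    then have "mirror_corner x \<in> corners ?B'" by (auto simp: corners_def)
    moreover have "mirror_corner (across T x) = across T (mirror_corner x)"
      by (cases x) auto
    ultimately show "(mirror_corner x, mirror_corner (across (twisted ?B) x)) \<in> same_component ?B'"
      using same_component_across[OF framed'] by simp
  next
    fix y assume "y \<in> corners ?B'"
    then have "mirror_corner y \<in> corners ?B" "mirror_corner (mirror_corner y) = y"
      by (auto simp: corners_def)
    then show "\<exists>x\<in>corners ?B. (mirror_corner x, y) \<in> same_component ?B'"
      by (metis same_component_refl)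
  qed (use assms False in auto)
  then show ?thesis by (intro euler_genus_le) auto
qed simp

lemma euler_genus_rev:
  assumes "framed_chord_diagram \<lparr>circle = c, twisted = T\<rparr>"
  shows "euler_genus \<lparr>circle = rev c, twisted = T\<rparr> = euler_genus \<lparr>circle = c, twisted = T\<rparr>"
proof -
  have "framed_chord_diagram \<lparr>circle = rev c, twisted = T\<rparr>"
    using assms by (simp add: framed_chord_diagram_def chords_def)
  then show ?thesis using euler_genus_rev_le[of c T] euler_genus_rev_le[of "rev c" T] assms by simp
qed

lemma framed_chord_diagram_cong:
  assumes "framed_chord_diagram \<lparr>circle = c, twisted = T\<rparr>"
    and "set c' = set c" "length c' = length c" "T' \<subseteq> fst ` set c"
  shows "framed_chord_diagram \<lparr>circle = c', twisted = T'\<rparr>"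
  using assms by (simp add: framed_chord_diagram_def chords_def card_distinct distinct_card)

text \<open>
  Before the slide the component through \<open>After a\<close> runs along the ribbon of \<open>b\<close>, from \<open>Before b\<close>
  to \<open>After b'\<close>, and goes on behind \<open>b'\<close>; after the slide it passes from \<open>After a\<close> directly to what
  lies behind \<open>b'\<close>, and it is the component through \<open>Before a\<close> that uses this side of the ribbon.
  Contracting the side \<open>Before b\<close>, \<open>After b'\<close> to \<open>After a\<close> therefore carries the old components to
  the new ones.
\<close>

lemma slide_untwisted_le:
  fixes a b :: "'e endpoint"
  assumes framed: "framed_chord_diagram \<lparr>circle = a # b # xs @ other_end b # ys, twisted = T\<rparr>"
    and "fst a \<noteq> fst b" and untwisted: "fst b \<notin> T"
  shows "euler_genus \<lparr>circle = a # b # xs @ other_end b # ys, twisted = T\<rparr>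
       \<le> euler_genus \<lparr>circle = b # xs @ other_end b # a # ys, twisted = T\<rparr>"
    (is "euler_genus ?B \<le> euler_genus ?B'")
proof -
  define b' where "b' = other_end b"
  have fst_b': "fst b' = fst b" "b' \<noteq> b" by (simp_all add: b'_def)
  have framed': "framed_chord_diagram ?B'"
    by (rule framed_chord_diagram_cong[OF framed])
      (use framed in \<open>auto simp: framed_chord_diagram_def chords_def\<close>)
  have corners: "corners ?B' = corners ?B" by (auto simp: corners_def)
  have dist: "distinct (a # b # xs @ b' # ys)"
    using framed by (simp add: framed_chord_diagram_def b'_def)
  have arcs: "immediately_before ?B p q \<longleftrightarrow>
      (p, q) = (a, b) \<or> (p, q) \<in> links (b # xs @ [b']) \<or> (p, q) \<in> links (b' # ys @ [a])" for p q
    using links_append[of "b # xs" b' "ys @ [a]"]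
    by (subst immediately_before_Cons[of _ a "b # xs @ b' # ys"]) (simp_all add: b'_def)
  have arcs': "immediately_before ?B' p q \<longleftrightarrow>
      (p, q) = (b', a) \<or> (p, q) \<in> links (b # xs @ [b']) \<or> (p, q) \<in> links (a # ys @ [b])" for p q
    using links_append[of "b # xs" b' "a # ys @ [b]"]
    by (subst immediately_before_Cons[of _ b "xs @ b' # a # ys"]) (auto simp: b'_def)
  have across': "(x, across T x) \<in> same_component ?B'" if "x \<in> corners ?B" for x
    using same_component_across[OF framed', of x] that corners by simp
  have sides: "(Before b, After b') \<in> same_component ?B'"
    using across'[of "Before b"] untwisted by (simp add: corners_def b'_def)
  \<comment> \<open>The two contracted corners lie on the component of \<open>Before a\<close> in the new diagram.\<close>
  have ba: "(Before b, Before a) \<in> same_component ?B'" "(After b', Before a) \<in> same_component ?B'"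
    using same_component_arc[of ?B' b' a] arcs' same_component_trans sides by auto
  define f where "f = (\<lambda>c. if c = Before b \<or> c = After b' then After a else c)"
  have "card (boundary_components ?B') \<le> card (boundary_components ?B)"
  proof (rule card_boundary_components_le[where f = f])
    fix p q assume "immediately_before ?B p q"
    then consider "(p, q) = (a, b)" | "(p, q) \<in> links (b # xs @ [b'])"
      | "(p, q) \<in> links (b' # ys @ [a])" using arcs by blast
    then show "(f (After p), f (Before q)) \<in> same_component ?B'"
    proof cases
      case 1
      then show ?thesis by (simp add: f_def)
    next
      case 2
      then have "p \<noteq> b'" "q \<noteq> b" using links_ends_in_set dist by fastforce+
      then show ?thesis using 2 arcs' same_component_arc by (fastforce simp: f_def)
    next
      case 3
      have q: "q \<noteq> b" using links_ends_in_set[OF 3] dist by auto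
      have "(if p = b' then a else p, if q = a then b else q) \<in> links (a # ys @ [b])"
        using 3 dist by (intro links_change_ends) auto
      then have "(After (if p = b' then a else p), Before (if q = a then b else q)) \<in> same_component ?B'"
        by (intro same_component_arc) (use arcs' in blast)
      then show ?thesis
        using q ba(1) same_component_trans by (fastforce simp: f_def split: if_splits)
    qed
  next
    fix x assume x: "x \<in> corners ?B"
    obtain p where p: "x = Before p \<or> x = After p" by (cases x) auto
    consider "p = b" | "p = b'" | "fst p \<noteq> fst b" using same_fst_cases[of p b] b'_def by auto
    then have "f x = f (across T x) \<or> f x = x \<and> f (across T x) = across T x"
    proof cases
      case 3
      then have "f (Before r) = Before r \<and> f (After r) = After r" if "r = p \<or> r = other_end p" for r
        using that fst_b' by (auto simp: f_def)
      from this[of p] this[of "other_end p"] show ?thesis using p by auto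
    qed (use p untwisted fst_b' in \<open>auto simp: f_def b'_def\<close>)
    then show "(f x, f (across (twisted ?B) x)) \<in> same_component ?B'"
      using across'[OF x] by auto
  next
    fix y assume y: "y \<in> corners ?B'"
    have "f (Before a) = Before a" "Before a \<in> corners ?B"
      using \<open>fst a \<noteq> fst b\<close> by (auto simp: f_def corners_def)
    moreover have "f y = y" if "y \<noteq> Before b" "y \<noteq> After b'" using that by (simp add: f_def)
    moreover have "(Before a, y) \<in> same_component ?B'" if "y = Before b \<or> y = After b'"
      using that ba same_component_sym[of _ _ ?B'] by auto
    moreover have "y \<in> corners ?B" using y corners by simp
    ultimately show "\<exists>x\<in>corners ?B. (f x, y) \<in> same_component ?B'"
      by (cases "y = Before b \<or> y = After b'") (force intro: bexI[of _ "Before a"] bexI[of _ y])+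
  qed (use framed in auto)
  then show ?thesis by (intro euler_genus_le) auto
qed

definition switch :: "'e \<Rightarrow> 'e set \<Rightarrow> 'e set" where
  "switch e S = (S - {e}) \<union> ({e} - S)"

lemma in_switch_iff [simp]: "x \<in> switch e S \<longleftrightarrow> (x = e) \<noteq> (x \<in> S)"
  by (auto simp: switch_def)

lemma switch_switch [simp]: "switch e (switch e S) = S"
  by auto

text \<open>
  The end \<open>a\<close> arrives at \<open>b'\<close> upside down: the roles of \<open>Before a\<close> and \<open>After a\<close> are exchanged, and
  switching the framing of \<open>a\<close> compensates this on the ribbon of \<open>a\<close>. As in the untwisted case, the
  side \<open>Before b\<close>, \<open>Before b'\<close> of the other ribbon is contracted to the corner it was joined to,
  namely to the image of \<open>After a\<close>.
\<close>

lemma slide_twisted_le: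
  fixes a b :: "'e endpoint"
  assumes framed: "framed_chord_diagram \<lparr>circle = a # b # xs @ other_end b # ys, twisted = T\<rparr>"
    and ab: "fst a \<noteq> fst b" and tw: "fst b \<in> T"
  shows "euler_genus \<lparr>circle = a # b # xs @ other_end b # ys, twisted = T\<rparr>
       \<le> euler_genus \<lparr>circle = b # xs @ a # other_end b # ys, twisted = switch (fst a) T\<rparr>"
    (is "euler_genus ?B \<le> euler_genus ?B'")
proof -
  define b' where "b' = other_end b"
  define T' where "T' = switch (fst a) T"
  have fst_b': "fst b' = fst b" "b' \<noteq> b" by (simp_all add: b'_def)
  have framed': "framed_chord_diagram ?B'"
    by (rule framed_chord_diagram_cong[OF framed])
      (use framed in \<open>auto simp: framed_chord_diagram_def chords_def\<close>)
  have corners: "corners ?B' = corners ?B" by (auto simp: corners_def)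
  have dist: "distinct (a # b # xs @ b' # ys)"
    using framed by (simp add: framed_chord_diagram_def b'_def)
  have arcs: "immediately_before ?B p q \<longleftrightarrow>
      (p, q) = (a, b) \<or> (p, q) \<in> links (b # xs @ [b']) \<or> (p, q) \<in> links (b' # ys @ [a])" for p q
    using links_append[of "b # xs" b' "ys @ [a]"]
    by (subst immediately_before_Cons[of _ a "b # xs @ b' # ys"]) (simp_all add: b'_def)
  have arcs': "immediately_before ?B' p q \<longleftrightarrow>
      (p, q) = (a, b') \<or> (p, q) \<in> links (b # xs @ [a]) \<or> (p, q) \<in> links (b' # ys @ [b])" for p q
    using links_append[of "b # xs" a "b' # ys @ [b]"]
    by (subst immediately_before_Cons[of _ b "xs @ a # b' # ys"]) (auto simp: b'_def)
  have across': "(x, across T' x) \<in> same_component ?B'" if "x \<in> corners ?B" for x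
    using same_component_across[OF framed', of x] that corners by (simp add: T'_def)
  have sides: "(Before b, Before b') \<in> same_component ?B'"
    using across'[of "Before b"] tw ab by (simp add: corners_def b'_def T'_def)
  have b'a: "(Before b', After a) \<in> same_component ?B'"
    using same_component_arc[of ?B' a b'] arcs' same_component_sym by auto
  then have ba: "(Before b, After a) \<in> same_component ?B'"
    using same_component_trans sides by blast
  define f where "f = (\<lambda>c. if c = After a \<or> c = Before b \<or> c = Before b' then Before a
    else if c = Before a then After a else c)"
  have "card (boundary_components ?B') \<le> card (boundary_components ?B)"
  proof (rule card_boundary_components_le[where f = f])
    fix p q assume "immediately_before ?B p q"
    then consider "(p, q) = (a, b)" | "(p, q) \<in> links (b # xs @ [b'])"
      | "(p, q) \<in> links (b' # ys @ [a])" using arcs by blast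
    then show "(f (After p), f (Before q)) \<in> same_component ?B'"
    proof cases
      case 1
      then show ?thesis by (simp add: f_def)
    next
      case 2
      then have pq: "p \<noteq> a" "q \<noteq> b" "q \<noteq> a" using links_ends_in_set dist by fastforce+
      have "(if p = b then b else p, if q = b' then a else q) \<in> links (b # xs @ [a])"
        using 2 dist by (intro links_change_ends) auto
      then have "(After p, Before (if q = b' then a else q)) \<in> same_component ?B'"
        by (intro same_component_arc) (use arcs' in \<open>simp split: if_splits\<close>)
      then show ?thesis using pq by (auto simp: f_def)
    next
      case 3
      have pq: "p \<noteq> a" "q \<noteq> b" "q \<noteq> b'" using links_ends_in_set[OF 3] dist by auto
      have "(if p = b' then b' else p, if q = a then b else q) \<in> links (b' # ys @ [b])"
        using 3 dist by (intro links_change_ends) auto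
      then have "(After p, Before (if q = a then b else q)) \<in> same_component ?B'"
        by (intro same_component_arc) (use arcs' in \<open>simp split: if_splits\<close>)
      then show ?thesis
        using pq ba same_component_trans by (fastforce simp: f_def split: if_splits)
    qed
  next
    fix x assume x: "x \<in> corners ?B"
    obtain p where p: "x = Before p \<or> x = After p" by (cases x) auto
    consider "fst p = fst b" | "fst p = fst a" | "fst p \<noteq> fst b" "fst p \<noteq> fst a" by blast
    then have "f x = f (across T x) \<or> f (across T x) = across T' (f x) \<and> f x \<in> corners ?B"
    proof cases
      case 1
      then have "p = b \<or> p = b'" using same_fst_cases b'_def by blast
      moreover have "f (Before b) = Before a" "f (Before b') = Before a"
          "f (After b) = After b" "f (After b') = After b'"
        using ab fst_b' by (auto simp: f_def)
      moreover have "fst b \<in> T'" using tw ab by (simp add: T'_def)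
      ultimately show ?thesis using p tw x by (auto simp: b'_def)
    next
      case 2
      then have "p = a \<or> p = other_end a" using same_fst_cases by blast
      moreover have "f (Before a) = After a" "f (After a) = Before a"
          "f (Before (other_end a)) = Before (other_end a)"
          "f (After (other_end a)) = After (other_end a)"
        using ab fst_b' fst_other_end[of a] by (auto simp: f_def simp del: fst_other_end)
      moreover have "fst a \<in> T' \<longleftrightarrow> fst a \<notin> T" by (simp add: T'_def)
      moreover have "Before a \<in> corners ?B" "After a \<in> corners ?B" by (simp_all add: corners_def)
      ultimately show ?thesis using p x by (elim disjE) simp_all
    next
      case 3
      then have "f (Before r) = Before r \<and> f (After r) = After r" if "r = p \<or> r = other_end p" for r
        using that fst_b' by (auto simp: f_def)
      from this[of p] this[of "other_end p"] show ?thesis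
        using 3 p x by (auto simp: T'_def)
    qed
    then show "(f x, f (across (twisted ?B) x)) \<in> same_component ?B'"
      using across'[of "f x"] by auto
  next
    fix y assume y: "y \<in> corners ?B'"
    have fa: "f (Before a) = After a" "Before a \<in> corners ?B" "f (After a) = Before a" "After a \<in> corners ?B"
      using ab fst_b' by (auto simp: f_def corners_def)
    consider "y = Before b \<or> y = Before b'" | "y = After a" | "y = Before a" | "f y = y"
      unfolding f_def by (smt (verit))
    then show "\<exists>x\<in>corners ?B. (f x, y) \<in> same_component ?B'"
    proof cases
      case 1
      then have "(f (Before a), y) \<in> same_component ?B'"
        using fa ba b'a same_component_sym[of _ _ ?B'] by auto
      then show ?thesis using fa by blast
    next
      case 2
      then show ?thesis using fa by (intro bexI[of _ "Before a"]) simp_all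
    next
      case 3
      then show ?thesis using fa by (intro bexI[of _ "After a"]) simp_all
    next
      case 4
      then show ?thesis using y corners by (intro bexI[of _ y]) simp_all
    qed
  qed (use framed in auto)
  then show ?thesis by (intro euler_genus_le) auto
qed


text \<open>
  Read backwards, the slid circle has \<open>a\<close> immediately before \<open>b'\<close>, and sliding \<open>a\<close> along \<open>b'\<close> leads
  back to the original circle.
\<close>

lemma slide_untwisted_opposite:
  fixes a b :: "'e endpoint"
  assumes framed: "framed_chord_diagram \<lparr>circle = a # b # xs @ other_end b # ys, twisted = T\<rparr>"
    and ab: "fst a \<noteq> fst b" and untwisted: "fst b \<notin> T"
  shows "euler_genus \<lparr>circle = a # b # xs @ other_end b # ys, twisted = T\<rparr>
       = euler_genus \<lparr>circle = b # xs @ other_end b # a # ys, twisted = T\<rparr>"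
    (is "euler_genus ?B = euler_genus ?B'")
proof (rule antisym)
  show "euler_genus ?B \<le> euler_genus ?B'" by (rule slide_untwisted_le[OF assms])
  let ?C = "\<lparr>circle = a # other_end b # rev xs @ b # rev ys, twisted = T\<rparr>"
  have framed': "framed_chord_diagram ?B'" "framed_chord_diagram ?C"
    by (rule framed_chord_diagram_cong[OF framed];
        use framed in \<open>auto simp: framed_chord_diagram_def chords_def\<close>)+
  have "euler_genus ?B' = euler_genus \<lparr>circle = rev ys @ a # other_end b # rev xs @ [b], twisted = T\<rparr>"
    using euler_genus_rev[OF framed'(1)] by simp
  also have "\<dots> = euler_genus ?C" by (subst euler_genus_rotated) simp
  also have "\<dots> \<le> euler_genus \<lparr>circle = other_end b # rev xs @ b # a # rev ys, twisted = T\<rparr>"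
    using slide_untwisted_le[of a "other_end b" "rev xs" "rev ys" T] framed' ab untwisted by simp
  also have "\<dots> = euler_genus \<lparr>circle = rev (a # b # xs @ other_end b # ys), twisted = T\<rparr>"
    using euler_genus_rotated[of "rev ys" "other_end b # rev xs @ [b, a]" T] by simp
  also have "\<dots> = euler_genus ?B" by (rule euler_genus_rev[OF framed])
  finally show "euler_genus ?B' \<le> euler_genus ?B" .
qed

text \<open>
  The previous slide with \<open>b\<close> and \<open>b'\<close> exchanged, after rotating \<open>b'\<close> to the front.
\<close>

lemma slide_untwisted_facing:
  fixes a b :: "'e endpoint"
  assumes framed: "framed_chord_diagram \<lparr>circle = a # b # xs @ other_end b # ys, twisted = T\<rparr>"
    and ab: "fst a \<noteq> fst b" and untwisted: "fst b \<notin> T"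
  shows "euler_genus \<lparr>circle = b # a # xs @ other_end b # ys, twisted = T\<rparr>
       = euler_genus \<lparr>circle = b # xs @ a # other_end b # ys, twisted = T\<rparr>"
proof -
  have framed': "framed_chord_diagram
      \<lparr>circle = a # other_end b # ys @ other_end (other_end b) # xs, twisted = T\<rparr>"
    by (rule framed_chord_diagram_cong[OF framed])
      (use framed in \<open>auto simp: framed_chord_diagram_def chords_def\<close>)
  have "euler_genus \<lparr>circle = b # xs @ a # other_end b # ys, twisted = T\<rparr>
      = euler_genus \<lparr>circle = a # other_end b # ys @ b # xs, twisted = T\<rparr>"
    using euler_genus_rotated[of "b # xs" "a # other_end b # ys" T] by simp
  also have "\<dots> = euler_genus \<lparr>circle = other_end b # ys @ b # a # xs, twisted = T\<rparr>"
    using slide_untwisted_opposite[OF framed'] ab untwisted by simp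
  also have "\<dots> = euler_genus \<lparr>circle = b # a # xs @ other_end b # ys, twisted = T\<rparr>"
    using euler_genus_rotated[of "other_end b # ys" "b # a # xs" T] by simp
  finally show ?thesis ..
qed

text \<open>
  A slide along a twisted ribbon ends on the same side of \<open>b'\<close> as it started from at \<open>b\<close>; so a
  rotation, without reversal, suffices to recognise the reverse slide as one of the same kind.
\<close>

lemma slide_twisted_before:
  fixes a b :: "'e endpoint"
  assumes framed: "framed_chord_diagram \<lparr>circle = a # b # xs @ other_end b # ys, twisted = T\<rparr>"
    and ab: "fst a \<noteq> fst b" and tw: "fst b \<in> T"
  shows "euler_genus \<lparr>circle = a # b # xs @ other_end b # ys, twisted = T\<rparr>
       = euler_genus \<lparr>circle = b # xs @ a # other_end b # ys, twisted = switch (fst a) T\<rparr>"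
    (is "euler_genus ?B = euler_genus ?B'")
proof (rule antisym)
  show "euler_genus ?B \<le> euler_genus ?B'" by (rule slide_twisted_le[OF assms])
  define T' where "T' = switch (fst a) T"
  have framed': "framed_chord_diagram
      \<lparr>circle = a # other_end b # ys @ other_end (other_end b) # xs, twisted = T'\<rparr>"
    by (rule framed_chord_diagram_cong[OF framed])
      (use framed in \<open>auto simp: framed_chord_diagram_def chords_def T'_def\<close>)
  have "euler_genus ?B' = euler_genus \<lparr>circle = a # other_end b # ys @ b # xs, twisted = T'\<rparr>"
    using euler_genus_rotated[of "b # xs" "a # other_end b # ys" T'] by (simp add: T'_def)
  also have "\<dots> \<le> euler_genus \<lparr>circle = other_end b # ys @ a # b # xs, twisted = T\<rparr>"
    using slide_twisted_le[OF framed'] ab tw by (simp add: T'_def)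
  also have "\<dots> = euler_genus ?B"
    using euler_genus_rotated[of "other_end b # ys" "a # b # xs" T] by simp
  finally show "euler_genus ?B' \<le> euler_genus ?B" .
qed

text \<open>The mirror image of the previous slide.\<close>

lemma slide_twisted_after:
  fixes a b :: "'e endpoint"
  assumes framed: "framed_chord_diagram \<lparr>circle = a # b # xs @ other_end b # ys, twisted = T\<rparr>"
    and ab: "fst a \<noteq> fst b" and tw: "fst b \<in> T"
  shows "euler_genus \<lparr>circle = b # a # xs @ other_end b # ys, twisted = T\<rparr>
       = euler_genus \<lparr>circle = b # xs @ other_end b # a # ys, twisted = switch (fst a) T\<rparr>"
    (is "euler_genus ?B = euler_genus \<lparr>circle = _, twisted = ?T'\<rparr>")
proof -
  have framed': "framed_chord_diagram ?B"
    "framed_chord_diagram \<lparr>circle = b # xs @ other_end b # a # ys, twisted = ?T'\<rparr>"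
    "framed_chord_diagram \<lparr>circle = a # b # rev ys @ other_end b # rev xs, twisted = T\<rparr>"
    by (rule framed_chord_diagram_cong[OF framed];
        use framed in \<open>auto simp: framed_chord_diagram_def chords_def\<close>)+
  have "euler_genus ?B = euler_genus \<lparr>circle = a # b # rev ys @ other_end b # rev xs, twisted = T\<rparr>"
    using euler_genus_rev[OF framed'(1)]
      euler_genus_rotated[of "rev ys @ other_end b # rev xs" "[a, b]" T] by simp
  also have "\<dots> = euler_genus \<lparr>circle = b # rev ys @ a # other_end b # rev xs, twisted = ?T'\<rparr>"
    by (rule slide_twisted_before[OF framed'(3) ab tw])
  also have "\<dots> = euler_genus \<lparr>circle = b # xs @ other_end b # a # ys, twisted = ?T'\<rparr>"
    using euler_genus_rev[OF framed'(2)]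
      euler_genus_rotated[of "rev ys @ a # other_end b # rev xs" "[b]" ?T'] by simp
  finally show ?thesis .
qed


section \<open>The four-term relation for signed sums over framings\<close>

definition framing_term :: "'e endpoint list \<Rightarrow> 'e set \<Rightarrow> int poly" where
  "framing_term c S = monom ((-1) ^ card S) (nat (euler_genus \<lparr>circle = c, twisted = S\<rparr>))"

definition framing_sum :: "'e endpoint list \<Rightarrow> int poly" where
  "framing_sum c = (\<Sum>S\<in>Pow (fst ` set c). framing_term c S)"

lemma minus_one_power_card_sym_diff:
  assumes "finite A" "finite T"
  shows "(-1 :: int) ^ card ((T - A) \<union> (A - T)) = (-1) ^ card T * (-1) ^ card A"
proof -
  have "card ((T - A) \<union> (A - T)) = card (T - A) + card (A - T)"
    using assms by (intro card_Un_disjoint) auto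
  moreover have "card T = card (T - A) + card (T \<inter> A)" "card A = card (A - T) + card (T \<inter> A)"
    using assms by (metis add.commute card_Int_Diff, metis add.commute card_Int_Diff inf_commute)
  ultimately have "card T + card A = card ((T - A) \<union> (A - T)) + 2 * card (T \<inter> A)" by linarith
  then have "(-1 :: int) ^ (card T + card A) = (-1) ^ card ((T - A) \<union> (A - T))"
    by (simp only: power_add power_mult) simp
  then show ?thesis by (simp only: power_add)
qed

lemma smult_sum_right: "smult c (\<Sum>i\<in>I. f i) = (\<Sum>i\<in>I. smult c (f i))"
  by (induction I rule: infinite_finite_induct) (simp_all add: smult_add_right)

text \<open>
  Toggling by \<open>A\<close> is the involution \<open>D\<close> exchanging \<open>A\<close> with the framing that it produces, so the
  sum can be taken over framings at the cost of one global sign.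
\<close>

lemma modified_partial_petrial_poly_eq:
  assumes "twisted B \<subseteq> chords B"
  shows "modified_partial_petrial_poly B = smult ((-1) ^ card (twisted B)) (framing_sum (circle B))"
proof -
  define T where "T = twisted B"
  define D where "D = (\<lambda>A. (T - A) \<union> (A - T))"
  have fin: "finite (chords B)" "finite T"
    using assms by (auto simp: chords_def T_def intro: finite_subset)
  have "monom ((-1) ^ card A) (nat (euler_genus (partial_petrial B A)))
      = smult ((-1) ^ card T) (framing_term (circle B) (D A))" if "A \<in> Pow (chords B)" for A
  proof -
    have "finite A" using that fin finite_subset by auto
    then have "(-1) ^ card T * (-1) ^ card (D A) = (-1 :: int) ^ card A"
      using fin minus_one_power_card_sym_diff[of A T]
      by (simp add: D_def flip: mult.assoc power_mult_distrib)
    moreover have "partial_petrial B A = \<lparr>circle = circle B, twisted = D A\<rparr>"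
      by (simp add: partial_petrial_def toggle_def D_def T_def)
    ultimately show ?thesis by (simp add: framing_term_def smult_monom)
  qed
  then have "modified_partial_petrial_poly B =
      smult ((-1) ^ card T) (\<Sum>A\<in>Pow (chords B). framing_term (circle B) (D A))"
    by (simp add: modified_partial_petrial_poly_def smult_sum_right)
  also have "(\<Sum>A\<in>Pow (chords B). framing_term (circle B) (D A)) = framing_sum (circle B)"
    unfolding framing_sum_def chords_def[symmetric]
    by (rule sum.reindex_bij_witness[where i = D and j = D])
      (use assms in \<open>auto simp: D_def T_def\<close>)
  finally show ?thesis by (simp add: T_def)
qed

text \<open>
  \<open>U\<close> and \<open>W\<close> are the framings for which the ribbon of \<open>b\<close> is untwisted and twisted. On \<open>W\<close> the
  slide identity shifts the framing by \<open>switch (fst a)\<close>, a sign-reversing involution of \<open>W\<close>.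
\<close>

lemma four_term_framing_sum:
  fixes a b :: "'e endpoint"
  assumes framed: "framed_chord_diagram \<lparr>circle = a # b # xs @ other_end b # ys, twisted = T\<rparr>"
    and ab: "fst a \<noteq> fst b"
  shows "framing_sum (a # b # xs @ other_end b # ys) + framing_sum (b # xs @ a # other_end b # ys)
       = framing_sum (b # a # xs @ other_end b # ys) + framing_sum (b # xs @ other_end b # a # ys)"
    (is "framing_sum ?c1 + framing_sum ?c4 = framing_sum ?c2 + framing_sum ?c3")
proof -
  define E where "E = fst ` set ?c1"
  define U where "U = {S. S \<subseteq> E \<and> fst b \<notin> S}"
  define W where "W = {S. S \<subseteq> E \<and> fst b \<in> S}"
  have fin: "finite E" "finite U" "finite W" by (auto simp: E_def U_def W_def)
  have framed': "framed_chord_diagram \<lparr>circle = ?c1, twisted = S\<rparr>" if "S \<subseteq> E" for S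
    using framed that by (auto simp: framed_chord_diagram_def chords_def E_def)
  have E: "fst ` set ?c2 = E" "fst ` set ?c3 = E" "fst ` set ?c4 = E"
    by (auto simp: E_def)
  have split: "framing_sum c = (\<Sum>S\<in>U. framing_term c S) + (\<Sum>S\<in>W. framing_term c S)"
    if "fst ` set c = E" for c
  proof -
    have "Pow E = U \<union> W" by (auto simp: U_def W_def)
    then show ?thesis
      using that fin by (simp add: framing_sum_def) (subst sum.union_disjoint, auto simp: U_def W_def)
  qed
  have U13: "(\<Sum>S\<in>U. framing_term ?c1 S) = (\<Sum>S\<in>U. framing_term ?c3 S)"
    unfolding framing_term_def
    by (intro sum.cong refl arg_cong2[where f = monom] arg_cong[where f = nat]
        slide_untwisted_opposite framed' ab) (simp_all add: U_def)
  have U24: "(\<Sum>S\<in>U. framing_term ?c2 S) = (\<Sum>S\<in>U. framing_term ?c4 S)"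
    unfolding framing_term_def
    by (intro sum.cong refl arg_cong2[where f = monom] arg_cong[where f = nat]
        slide_untwisted_facing framed' ab) (simp_all add: U_def)
  have W: "(\<Sum>S\<in>W. framing_term c S) = - (\<Sum>S\<in>W. framing_term c' S)"
    if "\<And>S. S \<in> W \<Longrightarrow> euler_genus \<lparr>circle = c, twisted = S\<rparr>
      = euler_genus \<lparr>circle = c', twisted = switch (fst a) S\<rparr>" for c c'
  proof -
    have "framing_term c S = - framing_term c' (switch (fst a) S)" if "S \<in> W" for S
    proof -
      have "finite S" using that fin finite_subset by (auto simp: W_def)
      then have "(-1 :: int) ^ card (switch (fst a) S) = - ((-1) ^ card S)"
        using minus_one_power_card_sym_diff[of "{fst a}" S] by (simp add: switch_def)
      then show ?thesis
        using \<open>\<And>S. S \<in> W \<Longrightarrow> _\<close>[OF that] by (simp add: framing_term_def flip: minus_monom)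
    qed
    then have "(\<Sum>S\<in>W. framing_term c S) = - (\<Sum>S\<in>W. framing_term c' (switch (fst a) S))"
      by (simp add: sum_negf)
    also have "(\<Sum>S\<in>W. framing_term c' (switch (fst a) S)) = (\<Sum>S\<in>W. framing_term c' S)"
      by (rule sum.reindex_bij_witness[where i = "switch (fst a)" and j = "switch (fst a)"])
        (use ab in \<open>auto simp: W_def E_def\<close>)
    finally show ?thesis .
  qed
  have W14: "(\<Sum>S\<in>W. framing_term ?c1 S) = - (\<Sum>S\<in>W. framing_term ?c4 S)"
    by (intro W slide_twisted_before framed' ab) (simp_all add: W_def)
  have W23: "(\<Sum>S\<in>W. framing_term ?c2 S) = - (\<Sum>S\<in>W. framing_term ?c3 S)"
    by (intro W slide_twisted_after framed' ab) (simp_all add: W_def)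
  show ?thesis
    using split[of ?c1] split[OF E(1)] split[OF E(2)] split[OF E(3)] U13 U24 W14 W23
    by (simp add: E_def)
qed


section \<open>The four-term relation\<close>

text \<open>
  The base point of the circle is immaterial. Rotation commutes with all operations that rewrite
  the circle letter by letter, so the two adjacent ends may be assumed to stand at the front.
\<close>

definition rotation_of :: "'e diagram \<Rightarrow> 'e diagram \<Rightarrow> bool" where
  "rotation_of B B' \<longleftrightarrow> (\<exists>u v. circle B = u @ v \<and> circle B' = v @ u) \<and> twisted B = twisted B'"

lemma modified_partial_petrial_poly_rotation:
  assumes "rotation_of B B'"
  shows "modified_partial_petrial_poly B = modified_partial_petrial_poly B'"
proof -
  obtain u v where uv: "circle B = u @ v" "circle B' = v @ u" and tw: "twisted B = twisted B'"
    using assms by (auto simp: rotation_of_def)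
  have "euler_genus (partial_petrial B A) = euler_genus (partial_petrial B' A)" for A
    using uv tw immediately_before_rotated[of "partial_petrial B A" u v "partial_petrial B' A"]
    by (intro euler_genus_cong) (auto simp: partial_petrial_def toggle_def)
  moreover have "chords B = chords B'" using uv by (auto simp: chords_def)
  ultimately show ?thesis by (simp add: modified_partial_petrial_poly_def)
qed

lemma rotation_of_concat_map:
  assumes "rotation_of B B'" "twisted C = twisted C'"
    and "circle C = concat (map g (circle B))" "circle C' = concat (map g (circle B'))"
  shows "rotation_of C C'"
proof -
  obtain u v where "circle B = u @ v" "circle B' = v @ u"
    using assms(1) unfolding rotation_of_def by blast
  then have "circle C = concat (map g u) @ concat (map g v)"
      "circle C' = concat (map g v) @ concat (map g u)"
    using assms(3,4) by simp_all
  then show ?thesis using assms(2) unfolding rotation_of_def by blast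
qed

lemma rotation_of_exchange_ends:
  assumes "rotation_of B B'"
  shows "rotation_of (exchange_ends p q B) (exchange_ends p q B')"
  by (rule rotation_of_concat_map[OF assms, where g = "\<lambda>r. [transpose p q r]"])
    (use assms in \<open>simp_all add: exchange_ends_def rotation_of_def concat_map_singleton\<close>)

lemma rotation_of_toggle:
  "rotation_of B B' \<Longrightarrow> rotation_of (toggle A B) (toggle A B')"
  by (simp add: rotation_of_def toggle_def)

lemma rotation_of_move:
  assumes "rotation_of B B'"
  shows "rotation_of (move_before p q B) (move_before p q B')"
    and "rotation_of (move_after p q B) (move_after p q B')"
proof -
  have tw: "twisted B = twisted B'" using assms by (simp add: rotation_of_def)
  show "rotation_of (move_before p q B) (move_before p q B')"
    by (rule rotation_of_concat_map[OF assms,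
          where g = "\<lambda>r. if r = p then [] else if r = q then [p, q] else [r]"])
      (simp_all add: move_before_def tw)
  show "rotation_of (move_after p q B) (move_after p q B')"
    by (rule rotation_of_concat_map[OF assms,
          where g = "\<lambda>r. if r = p then [] else if r = q then [q, p] else [r]"])
      (simp_all add: move_after_def tw)
qed

lemma rotation_of_slide_end:
  assumes "rotation_of B B'"
  shows "rotation_of (slide_end p q B) (slide_end p q B')"
proof -
  have "twisted B = twisted B'" using assms by (simp add: rotation_of_def)
  moreover have "immediately_before B p q = immediately_before B' p q"
    using assms immediately_before_rotated[of B _ _ B'] unfolding rotation_of_def by blast
  ultimately show ?thesis
    using assms by (simp add: slide_end_def rotation_of_move rotation_of_toggle)
qed

lemma exchange_ends_adjacent:
  assumes "distinct (us @ p # q # vs)"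
  shows "exchange_ends p q \<lparr>circle = us @ p # q # vs, twisted = T\<rparr>
       = \<lparr>circle = us @ q # p # vs, twisted = T\<rparr>"
    and "exchange_ends q p \<lparr>circle = us @ p # q # vs, twisted = T\<rparr>
       = \<lparr>circle = us @ q # p # vs, twisted = T\<rparr>"
  using assms by (auto simp: exchange_ends_def transpose_def intro!: map_idI)

lemma move_absent:
  assumes "p \<notin> set xs" "r \<notin> set xs"
  shows "concat (map (\<lambda>x. if x = p then [] else if x = r then ys else [x]) xs) = xs"
  using assms by (induction xs) auto


lemma slide_end_before:
  assumes dist: "distinct (a # b # xs @ other_end b # ys)"
  shows "slide_end a b \<lparr>circle = a # b # xs @ other_end b # ys, twisted = T\<rparr> =
     (if fst b \<notin> T then \<lparr>circle = b # xs @ other_end b # a # ys, twisted = T\<rparr>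
      else \<lparr>circle = b # xs @ a # other_end b # ys, twisted = switch (fst a) T\<rparr>)"
proof -
  have "immediately_before \<lparr>circle = a # b # xs @ other_end b # ys, twisted = T\<rparr> a b"
    by (subst immediately_before_Cons[of _ a "b # xs @ other_end b # ys"]) simp_all
  then show ?thesis
    using dist by (auto simp: slide_end_def move_before_def move_after_def toggle_def switch_def move_absent)
qed

text \<open>
  That \<open>a\<close> is not also immediately before \<open>b\<close> uses the presence of \<open>b'\<close> on the circle.
\<close>

lemma slide_end_after:
  assumes dist: "distinct (b # a # xs @ other_end b # ys)"
  shows "slide_end a b \<lparr>circle = b # a # xs @ other_end b # ys, twisted = T\<rparr> =
     (if fst b \<notin> T then \<lparr>circle = b # xs @ a # other_end b # ys, twisted = T\<rparr>
      else \<lparr>circle = b # xs @ other_end b # a # ys, twisted = switch (fst a) T\<rparr>)"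
proof -
  have "(a, b) \<notin> links (b # a # xs @ other_end b # ys @ [b])"
  proof
    assume "(a, b) \<in> links (b # a # xs @ other_end b # ys @ [b])"
    then have "(a, b) \<in> links (a # xs @ [other_end b]) \<or> (a, b) \<in> links (other_end b # ys @ [b])"
      using dist links_append[of "a # xs" "other_end b" "ys @ [b]"] by auto
    then show False using dist by (auto dest!: links_ends_in_set)
  qed
  then have "\<not> immediately_before \<lparr>circle = b # a # xs @ other_end b # ys, twisted = T\<rparr> a b"
    by (subst immediately_before_Cons[of _ b "a # xs @ other_end b # ys"]) simp_all
  then show ?thesis
    using dist by (auto simp: slide_end_def move_before_def move_after_def toggle_def switch_def move_absent)
qed

theorem lemma4p1:
  fixes B :: "'e diagram" and a b :: 'e and a\<^sub>1 b\<^sub>1 b\<^sub>2 :: "'e endpoint"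
  assumes "framed_chord_diagram B"
    and "a \<in> chords B" and "b \<in> chords B" and "a \<noteq> b"
    and "fst a\<^sub>1 = a" and "fst b\<^sub>1 = b" and "b\<^sub>2 = other_end b\<^sub>1"
    and "consecutive B a\<^sub>1 b\<^sub>1"
  shows "modified_partial_petrial_poly B
       - modified_partial_petrial_poly (slide_end a\<^sub>1 b\<^sub>1 B)
       + modified_partial_petrial_poly (exchange_ends a\<^sub>1 b\<^sub>2 (slide_end a\<^sub>1 b\<^sub>1 B))
       - modified_partial_petrial_poly (exchange_ends a\<^sub>1 b\<^sub>1 B) = 0"
proof -
  define T where "T = twisted B"
  have ab: "fst a\<^sub>1 \<noteq> fst b\<^sub>1" using assms by simp
  \<comment> \<open>\<open>p\<close> is whichever of the two ends comes first; cutting the circle there makes the word start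
      with \<open>a\<^sub>1 b\<^sub>1\<close> or \<open>b\<^sub>1 a\<^sub>1\<close>.\<close>
  obtain p q where pq: "p = a\<^sub>1 \<and> q = b\<^sub>1 \<or> p = b\<^sub>1 \<and> q = a\<^sub>1" and "immediately_before B p q"
    using assms(8) unfolding consecutive_def by blast
  then obtain u v w where uv: "circle B = u @ v" "v @ u = p # q # w"
    using ab immediately_before_obtains_rotation by metis
  have set: "set (p # q # w) = set (circle B)" and len: "length (p # q # w) = length (circle B)"
    using uv by (metis Un_commute set_append, metis add.commute length_append)
  have "b\<^sub>2 \<in> set (circle B)"
    using assms by (cases b\<^sub>1) (auto simp: framed_chord_diagram_def)
  moreover have "b\<^sub>2 \<noteq> a\<^sub>1" "b\<^sub>2 \<noteq> b\<^sub>1" using ab assms(7) by auto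
  ultimately have "b\<^sub>2 \<in> set w" using set pq by auto
  then obtain xs ys where w: "w = xs @ b\<^sub>2 # ys" by (meson split_list)
  define B\<^sub>0 where "B\<^sub>0 = \<lparr>circle = p # q # w, twisted = T\<rparr>"
  have "circle B\<^sub>0 = v @ u" "twisted B = twisted B\<^sub>0" using uv by (simp_all add: B\<^sub>0_def T_def)
  then have rot: "rotation_of B B\<^sub>0" using uv(1) unfolding rotation_of_def by blast
  let ?P = modified_partial_petrial_poly
  let ?c1 = "a\<^sub>1 # b\<^sub>1 # xs @ other_end b\<^sub>1 # ys" and ?c2 = "b\<^sub>1 # a\<^sub>1 # xs @ other_end b\<^sub>1 # ys"
  let ?c3 = "b\<^sub>1 # xs @ other_end b\<^sub>1 # a\<^sub>1 # ys" and ?c4 = "b\<^sub>1 # xs @ a\<^sub>1 # other_end b\<^sub>1 # ys"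
  let ?T' = "switch (fst a\<^sub>1) T"
  have "framed_chord_diagram \<lparr>circle = circle B, twisted = T\<rparr>"
    using assms(1) by (simp add: T_def framed_chord_diagram_def chords_def)
  then have framed: "framed_chord_diagram \<lparr>circle = ?c1, twisted = T\<rparr>"
    by (rule framed_chord_diagram_cong)
      (use set len pq w assms(1,7) in \<open>auto simp: framed_chord_diagram_def chords_def T_def\<close>)
  then have dist: "distinct ?c1" and tw: "T \<subseteq> fst ` set ?c1" and fin: "finite T"
    by (auto simp: framed_chord_diagram_def chords_def intro: finite_subset)
  define s :: int where "s = (-1) ^ card T"
  \<comment> \<open>A twisted slide also switches the framing of \<open>a\<^sub>1\<close>, which costs a sign.\<close>
  have P: "?P \<lparr>circle = c, twisted = T\<rparr> = smult s (framing_sum c)"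
      "?P \<lparr>circle = c, twisted = ?T'\<rparr> = - smult s (framing_sum c)"
    if "set c = set ?c1" for c
  proof -
    have "(-1) ^ card ?T' = - s"
      using minus_one_power_card_sym_diff[of "{fst a\<^sub>1}" T] fin by (simp add: s_def switch_def)
    then show "?P \<lparr>circle = c, twisted = T\<rparr> = smult s (framing_sum c)"
        "?P \<lparr>circle = c, twisted = ?T'\<rparr> = - smult s (framing_sum c)"
      using tw that by (subst modified_partial_petrial_poly_eq; auto simp: chords_def s_def)+
  qed
  have P_rot: "?P B = ?P B\<^sub>0" "?P (slide_end a\<^sub>1 b\<^sub>1 B) = ?P (slide_end a\<^sub>1 b\<^sub>1 B\<^sub>0)"
      "?P (exchange_ends a\<^sub>1 b\<^sub>2 (slide_end a\<^sub>1 b\<^sub>1 B)) = ?P (exchange_ends a\<^sub>1 b\<^sub>2 (slide_end a\<^sub>1 b\<^sub>1 B\<^sub>0))"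
      "?P (exchange_ends a\<^sub>1 b\<^sub>1 B) = ?P (exchange_ends a\<^sub>1 b\<^sub>1 B\<^sub>0)"
    using rot by (intro modified_partial_petrial_poly_rotation
        rotation_of_exchange_ends rotation_of_slide_end; assumption)+
  have neq: "b\<^sub>1 \<noteq> a\<^sub>1" "other_end b\<^sub>1 \<noteq> a\<^sub>1" using ab by auto
  have x12: "exchange_ends a\<^sub>1 b\<^sub>1 \<lparr>circle = ?c1, twisted = T\<rparr> = \<lparr>circle = ?c2, twisted = T\<rparr>"
      "exchange_ends a\<^sub>1 b\<^sub>1 \<lparr>circle = ?c2, twisted = T\<rparr> = \<lparr>circle = ?c1, twisted = T\<rparr>"
    using exchange_ends_adjacent(1)[of "[]" a\<^sub>1 b\<^sub>1 "xs @ other_end b\<^sub>1 # ys" T]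
      exchange_ends_adjacent(2)[of "[]" b\<^sub>1 a\<^sub>1 "xs @ other_end b\<^sub>1 # ys" T] dist neq by simp_all
  have x34: "exchange_ends a\<^sub>1 b\<^sub>2 \<lparr>circle = ?c3, twisted = S\<rparr> = \<lparr>circle = ?c4, twisted = S\<rparr>"
      "exchange_ends a\<^sub>1 b\<^sub>2 \<lparr>circle = ?c4, twisted = S\<rparr> = \<lparr>circle = ?c3, twisted = S\<rparr>" for S
    using exchange_ends_adjacent(2)[of "b\<^sub>1 # xs" "other_end b\<^sub>1" a\<^sub>1 ys S]
      exchange_ends_adjacent(1)[of "b\<^sub>1 # xs" a\<^sub>1 "other_end b\<^sub>1" ys S] dist neq assms(7) by simp_all
  have P1: "?P \<lparr>circle = ?c1, twisted = T\<rparr> = smult s (framing_sum ?c1)" by (rule P) simp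
  have P2: "?P \<lparr>circle = ?c2, twisted = T\<rparr> = smult s (framing_sum ?c2)" by (rule P) auto
  have P3: "?P \<lparr>circle = ?c3, twisted = T\<rparr> = smult s (framing_sum ?c3)"
    "?P \<lparr>circle = ?c3, twisted = ?T'\<rparr> = - smult s (framing_sum ?c3)" by (rule P; auto)+
  have P4: "?P \<lparr>circle = ?c4, twisted = T\<rparr> = smult s (framing_sum ?c4)"
    "?P \<lparr>circle = ?c4, twisted = ?T'\<rparr> = - smult s (framing_sum ?c4)" by (rule P; auto)+
  have four_term: "smult s (framing_sum ?c1) + smult s (framing_sum ?c4)
      - smult s (framing_sum ?c2) - smult s (framing_sum ?c3) = 0"
    using arg_cong[OF four_term_framing_sum[OF framed ab], of "smult s"]
    by (simp add: smult_add_right)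
  consider "B\<^sub>0 = \<lparr>circle = ?c1, twisted = T\<rparr>" | "B\<^sub>0 = \<lparr>circle = ?c2, twisted = T\<rparr>"
    using pq w assms(7) by (auto simp: B\<^sub>0_def)
  then show ?thesis
  proof cases
    case 1
    have "slide_end a\<^sub>1 b\<^sub>1 B\<^sub>0 = (if fst b\<^sub>1 \<notin> T then \<lparr>circle = ?c3, twisted = T\<rparr>
        else \<lparr>circle = ?c4, twisted = ?T'\<rparr>)"
      using 1 slide_end_before[OF dist] by simp
    then show ?thesis
      unfolding P_rot using four_term 1 x12 x34 P1 P2 P3 P4
      by (cases "fst b\<^sub>1 \<in> T") (simp_all add: algebra_simps)
  next
    case 2
    have "slide_end a\<^sub>1 b\<^sub>1 B\<^sub>0 = (if fst b\<^sub>1 \<notin> T then \<lparr>circle = ?c4, twisted = T\<rparr>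
        else \<lparr>circle = ?c3, twisted = ?T'\<rparr>)"
      using 2 slide_end_after[of b\<^sub>1 a\<^sub>1 xs ys T] dist by auto
    then show ?thesis
      unfolding P_rot using four_term 2 x12 x34 P1 P2 P3 P4
      by (cases "fst b\<^sub>1 \<in> T") (simp_all add: algebra_simps)
  qed
qed

end
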